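(* For every real number $\Lambda$ with \[ 2<\Lambda\leqslant \frac{3+\sqrt2}{2} \] there exists a closed codimension-$2$ subspace $Y$ of the real Banach space $C[0,1]$ such that \[ \lambda(Y,C[0,1])=\Lambda, \] and the infimum defining $\lambda(Y,C[0,1])$ is not attained.
   Context: $C[0,1]$ is the real Banach space of continuous real-valued functions on $[0,1]$ with the supremum norm. For a closed subspace $E$ of a Banach space $F$, the projection constant of $E$ in $F$ is $\lambda(E,F)=\inf\{\|P\| : P\colon F\to E \text{ bounded linear},\ P|_E=\mathrm{Id}_E\}$. *)

theory Defs
  imports "HOL-Analysis.Analysis"
begin

typedef unit_interval = "{0..1::real}"
  by auto

instantiation unit_interval :: metric_space
begin

definition dist_unit_interval :: "unit_interval \<Rightarrow> unit_interval \<Rightarrow> real"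
  where "dist_unit_interval s t = dist (Rep_unit_interval s) (Rep_unit_interval t)"

definition uniformity_unit_interval :: "(unit_interval \<times> unit_interval) filter"
  where "uniformity_unit_interval = (INF e\<in>{0<..}. principal {(s, t). dist s t < e})"

definition open_unit_interval :: "unit_interval set \<Rightarrow> bool"
  where "open_unit_interval U =
    (\<forall>s\<in>U. eventually (\<lambda>(s', t). s' = s \<longrightarrow> t \<in> U) uniformity)"

instance
proof
  fix s t u :: unit_interval
  show "dist s t = 0 \<longleftrightarrow> s = t"
    by (simp add: dist_unit_interval_def Rep_unit_interval_inject)
  show "dist s t \<le> dist s u + dist t u"
    by (simp add: dist_unit_interval_def dist_triangle2)
qed (simp_all only: uniformity_unit_interval_def open_unit_interval_def)

end

text \<open>
  \<open>C01\<close> is the library space of bounded continuous functions, with its supremum norm.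
  As \<open>[0,1]\<close> is compact, boundedness excludes nothing; see \<open>bcontfun_unit_interval\<close>.
\<close>
type_synonym C01 = "unit_interval \<Rightarrow>\<^sub>C real"

lemma compact_UNIV_unit_interval: "compact (UNIV :: unit_interval set)"
proof -
  have "continuous_on {0..1} Abs_unit_interval"
    unfolding continuous_on_iff
    by (auto simp: dist_unit_interval_def Abs_unit_interval_inverse)
  moreover have "Abs_unit_interval ` {0..1} = UNIV"
    by (metis type_definition.Abs_image type_definition_unit_interval)
  ultimately show ?thesis
    using compact_continuous_image[of "{0..1}" Abs_unit_interval] by simp
qed

lemma bcontfun_unit_interval:
  "(bcontfun :: (unit_interval \<Rightarrow> real) set) = {f. continuous_on UNIV f}"
  using compact_continuous_image[OF _ compact_UNIV_unit_interval]
  by (auto simp: bcontfun_def intro: compact_imp_bounded)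

definition projections_onto :: "'a::real_normed_vector set \<Rightarrow> ('a \<Rightarrow> 'a) set"
  where "projections_onto E = {P. bounded_linear P \<and> range P \<subseteq> E \<and> (\<forall>x\<in>E. P x = x)}"

text \<open>
  \<open>projection_constant E\<close> is $\lambda(E,F)$ with \<open>F\<close> the whole type \<open>'a\<close>. The infimum is
  taken in the extended reals, so that it is \<open>\<infinity>\<close> when there are no projections.
\<close>
definition projection_constant :: "'a::real_normed_vector set \<Rightarrow> ereal"
  where "projection_constant E = (INF P\<in>projections_onto E. ereal (onorm P))"

definition projection_constant_attained :: "'a::real_normed_vector set \<Rightarrow> bool"
  where "projection_constant_attained E \<longleftrightarrow>
    (\<exists>P\<in>projections_onto E. ereal (onorm P) = projection_constant E)"

text \<open>
  \<open>has_codimension E n\<close>, for a linear subspace \<open>E\<close>, says that the quotient by \<open>E\<close> has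
  dimension \<open>n\<close>: the cosets of the elements of \<open>B\<close> form a basis of the quotient.
\<close>
definition has_codimension :: "'a::real_vector set \<Rightarrow> nat \<Rightarrow> bool"
  where "has_codimension E n \<longleftrightarrow>
    (\<exists>B. finite B \<and> card B = n \<and>
      (\<forall>c. (\<Sum>b\<in>B. c b *\<^sub>R b) \<in> E \<longrightarrow> (\<forall>b\<in>B. c b = 0)) \<and>
      (\<forall>x. \<exists>c. x - (\<Sum>b\<in>B. c b *\<^sub>R b) \<in> E))"

end

theory Submission imports Defs begin

text \<open>
  Divide \<open>[0,1]\<close> into four quarters, let \<open>avg k\<close> be the mean over the \<open>k\<close>-th one, and for
  \<open>s > 0\<close> let \<open>Y\<close> be the common kernel of
  \<open>\<mu>\<^sub>1 = avg 0 + s (avg 2 + avg 3)\<close> and \<open>\<mu>\<^sub>2 = avg 1 + s (avg 2 - avg 3)\<close>.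
  The total variation norm on the span of these two functionals is
  \<open>\<parallel>a \<mu>\<^sub>1 + b \<mu>\<^sub>2\<parallel> = \<bar>a\<bar> + \<bar>b\<bar> + s (\<bar>a + b\<bar> + \<bar>a - b\<bar>) = N a b\<close>, whose unit ball is an octagon;
  as \<open>s\<close> runs from \<open>0\<close> to \<open>1 / sqrt 2\<close>, the ball changes from a square to a regular octagon.

  Every projection onto \<open>Y\<close> has the form \<open>P h = h - \<mu>\<^sub>1 h \<cdot> f - \<mu>\<^sub>2 h \<cdot> g\<close>, where
  \<open>f\<close>, \<open>g\<close> are continuous and biorthogonal to \<open>\<mu>\<^sub>1\<close>, \<open>\<mu>\<^sub>2\<close>. Since the measures have no atoms,
  the functional \<open>h \<mapsto> P h t\<close> is a point mass plus a measure that does not charge \<open>t\<close>, and hence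
  \<open>\<parallel>P\<parallel> = 1 + (SUP t. N (f t) (g t))\<close>. So one has to find the least \<open>K\<close> such that the curve
  \<open>(f, g)\<close> stays in the octagon \<open>N \<le> K\<close>.

  The trace \<open>\<mu>\<^sub>1 f + \<mu>\<^sub>2 g = 2\<close> is a sum of means of the linear forms \<open>a\<close>, \<open>b\<close>, \<open>a + b\<close>, \<open>a - b\<close>
  along the curve. Each form attains its maximum over the octagon at a single vertex, and
  inserting these maxima gives \<open>K \<ge> M = 1 + s / (1 + 2 s + 2 s\<^sup>2)\<close>. If \<open>K = M\<close>, all these
  means are maximal. Then by continuity \<open>f\<close> is maximal on the whole quarter \<open>0\<close> and \<open>g\<close> on
  the whole quarter \<open>1\<close>, so at the common end point \<open>1/4\<close> both are, which
  takes the curve out of the octagon (\<open>oct_norm_not_le_oct_constant\<close>). So the value \<open>M\<close> is never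
  attained. It is approached (\<open>almost_optimal_pair\<close>) by curves that spend most of the time of each
  quarter near the optimal vertex and return to the origin at the ends.

  Hence \<open>\<lambda>(Y, C[0,1]) = 1 + M\<close> is not attained, and \<open>M - 1\<close> takes every value in
  \<open>(0, (sqrt 2 - 1) / 2]\<close>, with the largest one at the regular octagon.
\<close>

section \<open>Means over the quarters of the unit interval\<close>

definition quarter :: "nat \<Rightarrow> real set"
  where "quarter k = {real k / 4..(real k + 1) / 4}"

definition avg :: "nat \<Rightarrow> C01 \<Rightarrow> real"
  where "avg k h = 4 * integral (quarter k) (\<lambda>x. h (Abs_unit_interval x))"

lemma Bcontfun_unit_interval_apply:
  fixes f :: "unit_interval \<Rightarrow> real"
  assumes "continuous_on UNIV f"
  shows "apply_bcontfun (Bcontfun f) = f"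
  using assms by (intro Bcontfun_inverse) (simp add: bcontfun_unit_interval)

lemma continuous_on_Rep_unit_interval [continuous_intros]:
  "continuous_on S Rep_unit_interval"
  unfolding continuous_on_iff by (auto simp: dist_unit_interval_def)

lemma quarter_subset: "k < 4 \<Longrightarrow> quarter k \<subseteq> {0..1}"
  by (auto simp: quarter_def)

lemma Rep_Abs_quarter: "k < 4 \<Longrightarrow> x \<in> quarter k \<Longrightarrow> Rep_unit_interval (Abs_unit_interval x) = x"
  using quarter_subset by (blast intro: Abs_unit_interval_inverse)

lemma continuous_on_quarter:
  fixes h :: C01
  assumes "k < 4"
  shows "continuous_on (quarter k) (\<lambda>x. h (Abs_unit_interval x))"
proof -
  have "continuous_on (quarter k) Abs_unit_interval"
    unfolding continuous_on_iff using assms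
    by (auto simp: dist_unit_interval_def Rep_Abs_quarter)
  then show ?thesis
    by (rule continuous_on_compose2[OF continuous_on_apply_bcontfun[of UNIV h]]) simp
qed

lemma integrable_on_quarter:
  fixes h :: C01
  assumes "k < 4"
  shows "(\<lambda>x. h (Abs_unit_interval x)) integrable_on quarter k"
  using continuous_on_quarter[OF assms, of h] unfolding quarter_def
  by (rule integrable_continuous_interval)

lemma integral_const_quarter: "integral (quarter k) (\<lambda>x. c :: real) = c / 4"
  by (simp add: quarter_def field_simps)

lemma avg_add: "k < 4 \<Longrightarrow> avg k (g + h) = avg k g + avg k h"
  by (simp add: avg_def integral_add integrable_on_quarter)

lemma avg_scaleR: "avg k (c *\<^sub>R h) = c * avg k h"
  by (simp add: avg_def)

lemma avg_diff: "k < 4 \<Longrightarrow> avg k (g - h) = avg k g - avg k h"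
  by (simp add: avg_def integral_diff integrable_on_quarter)

lemma avg_const_bcontfun: "avg k (const_bcontfun c) = c"
  by (simp add: avg_def const_bcontfun.rep_eq integral_const_quarter)

lemma avg_le:
  fixes h :: C01
  assumes "k < 4" and "\<And>t. h t \<le> c"
  shows "avg k h \<le> c"
proof -
  have "integral (quarter k) (\<lambda>x. h (Abs_unit_interval x)) \<le> integral (quarter k) (\<lambda>x. c)"
    using assms by (intro integral_le integrable_on_quarter) (auto simp: quarter_def)
  then show ?thesis by (simp add: avg_def integral_const_quarter)
qed

lemma abs_avg_le_norm:
  assumes "k < 4"
  shows "\<bar>avg k h\<bar> \<le> norm h"
proof -
  have "h t \<le> norm h" "(- 1 *\<^sub>R h) t \<le> norm h" for t
    using norm_bounded[of h t] by auto
  then have "avg k h \<le> norm h" "avg k (- 1 *\<^sub>R h) \<le> norm h"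
    by (intro avg_le assms; blast)+
  then show ?thesis unfolding avg_scaleR by linarith
qed

lemma bounded_linear_avg: "k < 4 \<Longrightarrow> bounded_linear (avg k)"
  using abs_avg_le_norm
  by (intro bounded_linear_intro[where K = 1]) (auto simp: avg_add avg_scaleR)

text \<open>
  Continuity enters here: a continuous function below \<open>c\<close> with mean \<open>c\<close> equals \<open>c\<close> also at the
  end points of the quarter. This is what makes neighbouring quarters interact.
\<close>

lemma avg_eq_upper_bound_imp_eq:
  fixes h :: C01
  assumes k: "k < 4" and le: "\<And>t. h t \<le> c" and eq: "avg k h = c"
    and t: "Rep_unit_interval t \<in> quarter k"
  shows "h t = c"
proof -
  let ?g = "const_bcontfun c - h"
  have "avg k ?g = 0"
    using k eq by (simp add: avg_diff avg_const_bcontfun)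
  then have 0: "integral (quarter k) (\<lambda>x. ?g (Abs_unit_interval x)) = 0"
    by (simp add: avg_def)
  have "\<forall>x\<in>quarter k. ?g (Abs_unit_interval x) = 0"
    using 0 continuous_on_quarter[OF k, of ?g] unfolding quarter_def
    by (rule iffD1[OF integral_eq_0_iff, rotated -1])
      (use le in \<open>auto simp: const_bcontfun.rep_eq\<close>)
  with t show ?thesis
    by (force simp: Rep_unit_interval_inverse const_bcontfun.rep_eq)
qed

text \<open>
  The functions in use are controlled only in the interior of a quarter and away from one
  point \<open>p\<close>. These exceptions form a finite set, so after changing the functions there to \<open>c\<close>
  dominated convergence applies.
\<close>

lemma avg_tendsto:
  fixes h :: "nat \<Rightarrow> C01"
  assumes k: "k < 4" and bound: "\<And>n t. \<bar>h n t\<bar> \<le> 1"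
    and lim: "\<And>t. Rep_unit_interval t \<in> interior (quarter k) \<Longrightarrow> t \<noteq> p \<Longrightarrow> (\<lambda>n. h n t) \<longlonglongrightarrow> c"
  shows "(\<lambda>n. avg k (h n)) \<longlonglongrightarrow> c"
proof -
  let ?N = "{real k / 4, (real k + 1) / 4, Rep_unit_interval p}"
  let ?H = "\<lambda>n x. if x \<in> ?N then c else h n (Abs_unit_interval x)"
  have neg: "negligible ?N" by simp
  have int: "?H n integrable_on quarter k" for n
    using integrable_spike[OF integrable_on_quarter[OF k, of "h n"] neg, of "?H n"] by auto
  have "(\<lambda>n. integral (quarter k) (?H n)) \<longlonglongrightarrow> integral (quarter k) (\<lambda>x. c)"
  proof (rule dominated_convergence(2)[OF int, where h = "\<lambda>x. 1 + \<bar>c\<bar>"])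
    show "(\<lambda>x. 1 + \<bar>c\<bar>) integrable_on quarter k"
      by (simp add: quarter_def integrable_const_ivl)
    show "norm (?H n x) \<le> 1 + \<bar>c\<bar>" for n x
      using bound[of n "Abs_unit_interval x"] by auto
    show "(\<lambda>n. ?H n x) \<longlonglongrightarrow> c" if x: "x \<in> quarter k" for x
    proof (cases "x \<in> ?N")
      case False
      then have "x \<in> interior (quarter k)" using x by (auto simp: quarter_def)
      moreover have "Abs_unit_interval x \<noteq> p" using False Rep_Abs_quarter[OF k x] by auto
      ultimately have "(\<lambda>n. h n (Abs_unit_interval x)) \<longlonglongrightarrow> c"
        using lim Rep_Abs_quarter[OF k x] by simp
      then show ?thesis using False by (simp only: if_False)
    qed simp
  qed
  moreover have "integral (quarter k) (?H n) = integral (quarter k) (\<lambda>x. h n (Abs_unit_interval x))" for n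
    by (rule integral_spike[OF neg]) auto
  ultimately have "(\<lambda>n. 4 * integral (quarter k) (\<lambda>x. h n (Abs_unit_interval x)))
      \<longlonglongrightarrow> 4 * (c / 4)"
    unfolding integral_const_quarter by (intro tendsto_mult_left) simp
  then show ?thesis by (simp add: avg_def)
qed

section \<open>Plateaus and spikes\<close>

text \<open>
  For large \<open>n\<close>, \<open>plateau k n\<close> is a continuous approximation from below to the indicator of the
  interior of the \<open>k\<close>-th quarter: a steep parabola that vanishes at the end points, cut off
  at \<open>0\<close> and \<open>1\<close>.
\<close>

definition plateau :: "nat \<Rightarrow> nat \<Rightarrow> C01"
  where "plateau k n = Bcontfun (\<lambda>t. min 1 (max 0 (real n *
    ((Rep_unit_interval t - real k / 4) * ((real k + 1) / 4 - Rep_unit_interval t)))))"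

definition spike :: "unit_interval \<Rightarrow> nat \<Rightarrow> C01"
  where "spike t0 n = Bcontfun (\<lambda>t. max 0 (1 - real n * dist t t0))"

lemma plateau_apply:
  "plateau k n t = min 1 (max 0 (real n *
    ((Rep_unit_interval t - real k / 4) * ((real k + 1) / 4 - Rep_unit_interval t))))"
  unfolding plateau_def
  by (subst Bcontfun_unit_interval_apply) (auto intro!: continuous_intros)

lemma spike_apply: "spike t0 n t = max 0 (1 - real n * dist t t0)"
  unfolding spike_def
  by (subst Bcontfun_unit_interval_apply) (auto intro!: continuous_intros)

lemma plateau_range: "0 \<le> plateau k n t" "plateau k n t \<le> 1"
  by (auto simp: plateau_apply)

lemma spike_range: "0 \<le> spike t0 n t" "spike t0 n t \<le> 1"
  by (auto simp: spike_apply)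

lemma plateau_nonzero:
  assumes "plateau k n t \<noteq> 0"
  shows "Rep_unit_interval t \<in> interior (quarter k)"
proof -
  let ?x = "Rep_unit_interval t"
  have "0 < real n * ((?x - real k / 4) * ((real k + 1) / 4 - ?x))"
    by (rule ccontr) (use assms in \<open>simp add: plateau_apply not_less max_absorb1\<close>)
  then have "0 < (?x - real k / 4) * ((real k + 1) / 4 - ?x)"
    by (simp add: zero_less_mult_iff)
  then show ?thesis by (auto simp: quarter_def zero_less_mult_iff)
qed

lemma interior_quarter_disjoint:
  assumes "x \<in> interior (quarter j)" "x \<in> quarter k"
  shows "j = k"
proof -
  have "real j < real k + 1" "real k < real j + 1"
    using assms by (auto simp: quarter_def)
  then show ?thesis by linarith
qed

lemma plateau_disjoint:
  assumes "plateau j n t \<noteq> 0" "j \<noteq> k"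
  shows "plateau k n t = 0"
  using plateau_nonzero[of j n t] plateau_nonzero[of k n t] assms
    interior_quarter_disjoint[of _ j k] interior_subset[of "quarter k"] by blast

lemma avg_plateau_other:
  assumes "k < 4" "j \<noteq> k"
  shows "avg k (plateau j n) = 0"
proof -
  have "plateau j n (Abs_unit_interval x) = 0" if "x \<in> quarter k" for x
    using plateau_nonzero[of j n "Abs_unit_interval x"] that assms
      interior_quarter_disjoint[of x j k] Rep_Abs_quarter[of k x] by auto
  then have "integral (quarter k) (\<lambda>x. plateau j n (Abs_unit_interval x))
      = integral (quarter k) (\<lambda>x. 0)"
    by (rule integral_cong)
  then show ?thesis by (simp add: avg_def)
qed

lemma plateau_tendsto:
  assumes "Rep_unit_interval t \<in> interior (quarter k)"
  shows "(\<lambda>n. plateau k n t) \<longlonglongrightarrow> 1"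
proof -
  let ?x = "Rep_unit_interval t"
  let ?p = "(?x - real k / 4) * ((real k + 1) / 4 - ?x)"
  have p: "0 < ?p" using assms by (auto simp: quarter_def)
  have "eventually (\<lambda>n. 1 / ?p \<le> real n) sequentially"
    by (rule filterlim_at_top[THEN iffD1, OF filterlim_real_sequentially, rule_format])
  then have "eventually (\<lambda>n. plateau k n t = 1) sequentially"
  proof eventually_elim
    case (elim n)
    then have "1 \<le> real n * ?p" using p by (simp add: divide_le_eq)
    then show ?case by (simp add: plateau_apply)
  qed
  then show ?thesis by (rule tendsto_eventually)
qed

lemma avg_plateau_tendsto: "k < 4 \<Longrightarrow> (\<lambda>n. avg k (plateau k n)) \<longlonglongrightarrow> 1"
  by (intro avg_tendsto plateau_tendsto) (use plateau_range in \<open>auto simp: abs_of_nonneg\<close>)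

lemma spike_tendsto:
  assumes "t \<noteq> t0"
  shows "(\<lambda>n. spike t0 n t) \<longlonglongrightarrow> 0"
proof -
  have p: "0 < dist t t0" using assms by simp
  have "eventually (\<lambda>n. 1 / dist t t0 \<le> real n) sequentially"
    by (rule filterlim_at_top[THEN iffD1, OF filterlim_real_sequentially, rule_format])
  then have "eventually (\<lambda>n. spike t0 n t = 0) sequentially"
  proof eventually_elim
    case (elim n)
    then have "1 \<le> real n * dist t t0" using p by (simp add: divide_le_eq)
    then show ?case by (simp add: spike_apply)
  qed
  then show ?thesis by (rule tendsto_eventually)
qed

text \<open>
  A point has measure zero, so a function in the unit ball can have the value \<open>1\<close> at \<open>t0\<close> and
  means as close as desired to any values in \<open>[-1,1]\<close>: blend the step function \<open>\<sigma>\<close>,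
  smoothed by plateaus, with a spike at \<open>t0\<close>.
\<close>

lemma peaking_functions:
  assumes \<sigma>: "\<And>k. k < 4 \<Longrightarrow> \<bar>\<sigma> k\<bar> \<le> 1"
  obtains h :: "nat \<Rightarrow> C01"
  where "\<And>n. norm (h n) \<le> 1" "\<And>n. h n t0 = 1"
    "\<And>k. k < 4 \<Longrightarrow> (\<lambda>n. avg k (h n)) \<longlonglongrightarrow> \<sigma> k"
proof
  define g where "g n t = (\<Sum>k<4. \<sigma> k * plateau k n t)" for n t
  define h where "h n = Bcontfun (\<lambda>t. spike t0 n t + (1 - spike t0 n t) * g n t)" for n
  have apply_h: "h n t = spike t0 n t + (1 - spike t0 n t) * g n t" for n t
    unfolding h_def g_def
    by (subst Bcontfun_unit_interval_apply)
      (auto intro!: continuous_intros continuous_on_apply_bcontfun)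
  have g_single: "g n t = \<sigma> k * plateau k n t"
    if "k < 4" "Rep_unit_interval t \<in> quarter k" for n t k
  proof -
    have "g n t = (\<Sum>j<4. if j = k then \<sigma> k * plateau k n t else 0)"
      unfolding g_def
    proof (rule sum.cong)
      fix j
      show "\<sigma> j * plateau j n t = (if j = k then \<sigma> k * plateau k n t else 0)"
        using plateau_nonzero[of j n t] interior_quarter_disjoint[of _ j k] that by auto
    qed simp
    then show ?thesis using that by simp
  qed
  \<comment> \<open>At most one plateau is nonzero at \<open>t\<close>, so the bound on \<open>\<sigma>\<close> carries over to the sum.\<close>
  have g_le: "\<bar>g n t\<bar> \<le> 1" for n t
  proof -
    let ?x = "Rep_unit_interval t"
    have x: "0 \<le> ?x" "?x \<le> 1" using Rep_unit_interval[of t] by auto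
    have "?x \<in> quarter 0 \<or> ?x \<in> quarter 1 \<or> ?x \<in> quarter 2 \<or> ?x \<in> quarter 3"
      using x by (auto simp: quarter_def)
    moreover have "(0::nat) < 4" "(1::nat) < 4" "(2::nat) < 4" "(3::nat) < 4" by simp_all
    ultimately obtain k where k: "k < 4" "?x \<in> quarter k" by blast
    have "\<bar>\<sigma> k\<bar> * \<bar>plateau k n t\<bar> \<le> 1 * 1"
      using \<sigma>[OF k(1)] plateau_range[of k n t] by (intro mult_mono) auto
    then show ?thesis by (simp add: g_single[OF k] abs_mult)
  qed
  have h_le: "\<bar>h n t\<bar> \<le> 1" for n t
  proof -
    have "\<bar>h n t\<bar> \<le> \<bar>spike t0 n t\<bar> + \<bar>1 - spike t0 n t\<bar> * \<bar>g n t\<bar>"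
      unfolding apply_h abs_mult[symmetric] by (rule abs_triangle_ineq)
    also have "\<dots> \<le> \<bar>spike t0 n t\<bar> + \<bar>1 - spike t0 n t\<bar> * 1"
      using g_le by (intro add_left_mono mult_left_mono) auto
    also have "\<dots> = 1" using spike_range[of t0 n t] by simp
    finally show ?thesis .
  qed
  show "norm (h n) \<le> 1" for n using h_le by (intro norm_bound) simp
  show "h n t0 = 1" for n by (simp add: apply_h spike_apply)
  show "(\<lambda>n. avg k (h n)) \<longlonglongrightarrow> \<sigma> k" if k: "k < 4" for k
  proof (rule avg_tendsto[where p = t0, OF k h_le])
    fix t assume t: "Rep_unit_interval t \<in> interior (quarter k)" "t \<noteq> t0"
    have "h n t = spike t0 n t + (1 - spike t0 n t) * (\<sigma> k * plateau k n t)" for n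
      unfolding apply_h using g_single[OF k] t(1) interior_subset by (metis subsetD)
    moreover have "(\<lambda>n. spike t0 n t + (1 - spike t0 n t) * (\<sigma> k * plateau k n t))
        \<longlonglongrightarrow> 0 + (1 - 0) * (\<sigma> k * 1)"
      using t by (intro tendsto_intros spike_tendsto plateau_tendsto)
    ultimately show "(\<lambda>n. h n t) \<longlonglongrightarrow> \<sigma> k" by simp
  qed
qed

text \<open>
  A point mass and an atomless measure are mutually singular, so their norms add up. This is
  the only source of lower bounds for the norms of projections.
\<close>

lemma perturbed_evaluation_bound:
  assumes "\<And>h. \<bar>apply_bcontfun h t0 - (\<Sum>k<4. c k * avg k h)\<bar> \<le> K * norm h"
  shows "1 + (\<Sum>k<4. \<bar>c k\<bar>) \<le> K"
proof -
  obtain h :: "nat \<Rightarrow> C01" where h: "\<And>n. norm (h n) \<le> 1" "\<And>n. h n t0 = 1"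
      "\<And>k. k < 4 \<Longrightarrow> (\<lambda>n. avg k (h n)) \<longlonglongrightarrow> - sgn (c k)"
    by (rule peaking_functions[of "\<lambda>k. - sgn (c k)" t0]) (auto simp: sgn_if)
  have "1 \<le> norm (h 0)" using norm_bounded[of "h 0" t0] h(2) by simp
  moreover have "0 \<le> K * norm (h 0)" using assms[of "h 0"] by (rule order_trans[OF abs_ge_zero])
  ultimately have K: "0 \<le> K" by (auto simp: zero_le_mult_iff)
  have "(\<lambda>n. 1 - (\<Sum>k<4. c k * avg k (h n))) \<longlonglongrightarrow> 1 - (\<Sum>k<4. c k * - sgn (c k))"
    using h(3) by (intro tendsto_intros) auto
  moreover have "1 - (\<Sum>k<4. c k * avg k (h n)) \<le> K" for n
  proof -
    have "1 - (\<Sum>k<4. c k * avg k (h n)) \<le> K * norm (h n)"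
      using assms[of "h n"] h(2)[of n] by linarith
    also have "\<dots> \<le> K" using mult_left_mono[OF h(1) K, of n] by simp
    finally show ?thesis .
  qed
  ultimately have "1 - (\<Sum>k<4. c k * - sgn (c k)) \<le> K"
    by (intro LIMSEQ_le_const2) auto
  moreover have "c k * - sgn (c k) = - \<bar>c k\<bar>" for k
    by (simp add: sgn_if abs_if)
  ultimately show ?thesis by (simp add: sum_negf)
qed

section \<open>The octagonal norm\<close>

text \<open>
  The norm is \<open>\<bar>a\<bar> + \<bar>b\<bar> + 2 s max \<bar>a\<bar> \<bar>b\<bar>\<close>, written so that it shows the coefficient of each
  mean \<open>avg k\<close> in the functional with coordinates \<open>(a, b)\<close>. The unit ball has its vertices on the
  axes and on the diagonals. The number \<open>oct_constant s\<close> will be the infimum of the sizes of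
  biorthogonal curves \<open>(f, g)\<close> in this norm.
\<close>

definition oct_norm :: "real \<Rightarrow> real \<Rightarrow> real \<Rightarrow> real"
  where "oct_norm s a b = \<bar>a\<bar> + \<bar>b\<bar> + s * (\<bar>a + b\<bar> + \<bar>a - b\<bar>)"

definition oct_constant :: "real \<Rightarrow> real"
  where "oct_constant s = 1 + s / (1 + 2 * s + 2 * s\<^sup>2)"

text \<open>
  These are the supporting half-planes at the vertices that maximize \<open>a\<close>, \<open>b\<close>, \<open>a + b\<close>
  and \<open>a - b\<close>, the four linear forms in the trace.
\<close>

lemma oct_norm_ge:
  assumes "0 \<le> s"
  shows "(1 + 2 * s) * a \<le> oct_norm s a b" "(1 + 2 * s) * b \<le> oct_norm s a b"
    "(1 + s) * (a + b) \<le> oct_norm s a b" "(1 + s) * (a - b) \<le> oct_norm s a b"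
proof -
  have *: "c + s * d \<le> oct_norm s a b"
    if "c \<le> \<bar>a\<bar> + \<bar>b\<bar>" "d \<le> \<bar>a + b\<bar> + \<bar>a - b\<bar>" for c d
    unfolding oct_norm_def using assms that by (intro add_mono mult_left_mono) auto
  show "(1 + 2 * s) * a \<le> oct_norm s a b" "(1 + 2 * s) * b \<le> oct_norm s a b"
    "(1 + s) * (a + b) \<le> oct_norm s a b" "(1 + s) * (a - b) \<le> oct_norm s a b"
    using *[of a "2 * a"] *[of b "2 * b"] *[of "a + b" "a + b"] *[of "a - b" "a - b"]
    by (auto simp: algebra_simps)
qed

lemma oct_norm_diagonal: "0 \<le> c \<Longrightarrow> oct_norm s c c = (2 + 2 * s) * c"
  by (simp add: oct_norm_def algebra_simps)

text \<open>
  This is the defining property of the constant: half of the trace when all four linear forms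
  are at their maxima over the ball of radius \<open>oct_constant s\<close>.
\<close>

lemma oct_constant_eq:
  assumes "0 \<le> s"
  shows "oct_constant s * (1 / (1 + 2 * s) + s / (1 + s)) = 1"
proof -
  have "0 < 1 + 2 * s + 2 * s\<^sup>2" "0 < 1 + 2 * s" "0 < 1 + s"
    using assms by (auto intro!: add_pos_nonneg)
  then show ?thesis
    unfolding oct_constant_def by (simp add: divide_simps) algebra
qed

lemma oct_constant_pos: "0 \<le> s \<Longrightarrow> 0 < oct_constant s"
  unfolding oct_constant_def by (intro add_pos_nonneg) auto

text \<open>
  With \<open>d = m - 1\<close> one has to solve \<open>2 d s\<^sup>2 - (1 - 2 d) s + d = 0\<close>. The discriminant
  \<open>(1 - 2 d)\<^sup>2 - 8 d\<^sup>2\<close> is nonnegative because \<open>d \<le> (sqrt 2 - 1) / 2\<close>; it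
  vanishes for the regular octagon.
\<close>

lemma oct_constant_onto:
  assumes "1 < m" "m \<le> (1 + sqrt 2) / 2"
  obtains s where "0 < s" "oct_constant s = m"
proof
  define d where "d = m - 1"
  define r where "r = sqrt ((1 - 2 * d)\<^sup>2 - 8 * d\<^sup>2)"
  define s where "s = (1 - 2 * d + r) / (4 * d)"
  have d: "0 < d" "d \<le> (sqrt 2 - 1) / 2" using assms by (auto simp: d_def field_simps)
  have "(2 + 2 * sqrt 2) * d \<le> (2 + 2 * sqrt 2) * ((sqrt 2 - 1) / 2)"
    using d(2) by (intro mult_left_mono) auto
  also have "\<dots> = 1" by (simp add: field_simps)
  finally have le: "2 * sqrt 2 * d \<le> 1 - 2 * d" by (simp add: algebra_simps)
  then have "(2 * sqrt 2 * d)\<^sup>2 \<le> (1 - 2 * d)\<^sup>2"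
    using d by (intro power_mono) auto
  then have r2: "r\<^sup>2 = (1 - 2 * d)\<^sup>2 - 8 * d\<^sup>2"
    by (simp add: r_def power_mult_distrib)
  have "0 < 2 * sqrt 2 * d" using d by simp
  then have pos: "0 < 1 - 2 * d" using le by linarith
  have "0 \<le> r" unfolding r_def using \<open>(2 * sqrt 2 * d)\<^sup>2 \<le> (1 - 2 * d)\<^sup>2\<close>
    by (simp add: power_mult_distrib)
  then show s: "0 < s" using pos d by (simp add: s_def)
  have r: "r = 4 * d * s - (1 - 2 * d)" using d by (simp add: s_def)
  have "8 * d * (d * (1 + 2 * s + 2 * s\<^sup>2) - s) = 0"
    using r2 unfolding r by algebra
  then have "d * (1 + 2 * s + 2 * s\<^sup>2) = s" using d by simp
  moreover have "0 < 1 + 2 * s + 2 * s\<^sup>2" using s by (auto intro!: add_pos_nonneg)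
  ultimately have "s / (1 + 2 * s + 2 * s\<^sup>2) = d" by (metis nonzero_mult_div_cancel_right less_irrefl)
  then show "oct_constant s = m" by (simp add: oct_constant_def d_def)
qed

section \<open>The two functionals and their kernel\<close>

definition first_moment :: "real \<Rightarrow> C01 \<Rightarrow> real"
  where "first_moment s h = avg 0 h + s * (avg 2 h + avg 3 h)"

definition second_moment :: "real \<Rightarrow> C01 \<Rightarrow> real"
  where "second_moment s h = avg 1 h + s * (avg 2 h - avg 3 h)"

definition moment_kernel :: "real \<Rightarrow> C01 set"
  where "moment_kernel s = {h. first_moment s h = 0 \<and> second_moment s h = 0}"

lemma bounded_linear_first_moment: "bounded_linear (first_moment s)"
  unfolding first_moment_def
  by (intro bounded_linear_add bounded_linear_const_mult bounded_linear_avg) auto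

lemma bounded_linear_second_moment: "bounded_linear (second_moment s)"
  unfolding second_moment_def
  by (intro bounded_linear_add bounded_linear_sub bounded_linear_const_mult bounded_linear_avg) auto

lemmas moment_linear_simps =
  linear_simps[OF bounded_linear_first_moment] linear_simps[OF bounded_linear_second_moment]

lemma subspace_moment_kernel: "subspace (moment_kernel s)"
  by (auto simp: subspace_def moment_kernel_def moment_linear_simps)

lemma closed_moment_kernel: "closed (moment_kernel s)"
proof -
  have "closed (first_moment s -` {0})" "closed (second_moment s -` {0})"
    by (intro closed_vimage linear_continuous_on closed_singleton
        bounded_linear_first_moment bounded_linear_second_moment)+
  moreover have "moment_kernel s = first_moment s -` {0} \<inter> second_moment s -` {0}"
    by (auto simp: moment_kernel_def)
  ultimately show ?thesis by auto
qed

definition biorthogonal :: "real \<Rightarrow> C01 \<Rightarrow> C01 \<Rightarrow> bool"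
  where "biorthogonal s f g \<longleftrightarrow> first_moment s f = 1 \<and> first_moment s g = 0 \<and>
    second_moment s f = 0 \<and> second_moment s g = 1"

definition moment_projection :: "real \<Rightarrow> C01 \<Rightarrow> C01 \<Rightarrow> C01 \<Rightarrow> C01"
  where "moment_projection s f g h = h - first_moment s h *\<^sub>R f - second_moment s h *\<^sub>R g"

lemma bounded_linear_moment_projection: "bounded_linear (moment_projection s f g)"
  unfolding moment_projection_def
  by (intro bounded_linear_sub bounded_linear_ident bounded_linear_scaleR_const
      bounded_linear_first_moment bounded_linear_second_moment)

lemma moment_projection_in_kernel:
  "biorthogonal s f g \<Longrightarrow> moment_projection s f g h \<in> moment_kernel s"
  by (auto simp: moment_kernel_def moment_projection_def biorthogonal_def moment_linear_simps)

lemma moment_projection_in_projections: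
  "biorthogonal s f g \<Longrightarrow> moment_projection s f g \<in> projections_onto (moment_kernel s)"
  unfolding projections_onto_def
  using bounded_linear_moment_projection moment_projection_in_kernel
  by (auto simp: moment_projection_def moment_kernel_def)

text \<open>
  \<open>Id - P\<close> vanishes on the kernel, so it is determined by its values at any biorthogonal pair,
  and those values are the pair sought.
\<close>

lemma projection_eq_moment_projection:
  assumes P: "P \<in> projections_onto (moment_kernel s)" and bi: "biorthogonal s u v"
  obtains f g where "biorthogonal s f g" "P = moment_projection s f g"
proof
  interpret P: bounded_linear P using P by (simp add: projections_onto_def)
  have PK: "P x \<in> moment_kernel s" for x using P by (auto simp: projections_onto_def)
  show "biorthogonal s (u - P u) (v - P v)"
    using bi PK[of u] PK[of v]
    by (simp add: biorthogonal_def moment_kernel_def moment_linear_simps)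
  show "P = moment_projection s (u - P u) (v - P v)"
  proof
    fix h
    have "P (moment_projection s u v h) = moment_projection s u v h"
      using P moment_projection_in_kernel[OF bi] by (auto simp: projections_onto_def)
    then show "P h = moment_projection s (u - P u) (v - P v) h"
      unfolding moment_projection_def P.diff P.scaleR by (simp add: algebra_simps)
  qed
qed

lemma has_codimension_moment_kernel:
  assumes "biorthogonal s f g"
  shows "has_codimension (moment_kernel s) 2"
proof -
  have ne: "f \<noteq> g" using assms by (auto simp: biorthogonal_def)
  show ?thesis
    unfolding has_codimension_def
  proof (intro exI[of _ "{f, g}"] conjI allI impI)
    show "card {f, g} = 2" using ne by simp
    fix c assume "(\<Sum>b\<in>{f, g}. c b *\<^sub>R b) \<in> moment_kernel s"
    then show "\<forall>b\<in>{f, g}. c b = 0"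
      using ne assms by (auto simp: moment_kernel_def biorthogonal_def moment_linear_simps)
  next
    fix h
    let ?c = "\<lambda>b. if b = f then first_moment s h else second_moment s h"
    have "h - (\<Sum>b\<in>{f, g}. ?c b *\<^sub>R b) = moment_projection s f g h"
      using ne by (simp add: moment_projection_def)
    with moment_projection_in_kernel[OF assms, of h]
    show "\<exists>c. h - (\<Sum>b\<in>{f, g}. c b *\<^sub>R b) \<in> moment_kernel s"
      by (intro exI[of _ ?c]) simp
  qed simp
qed

section \<open>The norm of a projection\<close>

lemma sum_lessThan_4: "(\<Sum>k<4::nat. F k) = F 0 + F 1 + F 2 + (F 3 :: real)"
  by (simp add: eval_nat_numeral)

lemma moment_projection_apply:
  fixes f g h :: C01
  shows
  "moment_projection s f g h t = h t - (f t * avg 0 h + g t * avg 1 h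
    + s * (f t + g t) * avg 2 h + s * (f t - g t) * avg 3 h)"
  by (simp add: moment_projection_def first_moment_def second_moment_def algebra_simps)

lemma oct_norm_le_onorm:
  fixes f g :: C01
  assumes "0 \<le> s"
  shows "1 + oct_norm s (f t) (g t) \<le> onorm (moment_projection s f g)"
proof -
  define c where "c = (\<lambda>k::nat. if k = 0 then f t else if k = 1 then g t
    else if k = 2 then s * (f t + g t) else s * (f t - g t))"
  have "\<bar>apply_bcontfun h t - (\<Sum>k<4. c k * avg k h)\<bar> \<le> onorm (moment_projection s f g) * norm h" for h
  proof -
    have "h t - (\<Sum>k<4. c k * avg k h) = moment_projection s f g h t"
      by (simp add: sum_lessThan_4 c_def moment_projection_apply)
    moreover have "\<bar>moment_projection s f g h t\<bar> \<le> norm (moment_projection s f g h)"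
      using norm_bounded[of "moment_projection s f g h" t] by simp
    ultimately show ?thesis
      using onorm[OF bounded_linear_moment_projection, of s f g h] by simp
  qed
  from perturbed_evaluation_bound[OF this] show ?thesis
    using assms
    by (simp add: sum_lessThan_4 c_def oct_norm_def abs_mult distrib_left[of s "\<bar>_\<bar>"] add.assoc)
qed

lemma onorm_moment_projection_le:
  fixes f g :: C01
  assumes s: "0 \<le> s" and K: "\<And>t. oct_norm s (f t) (g t) \<le> K"
  shows "onorm (moment_projection s f g) \<le> 1 + K"
proof (rule onorm_bound)
  show "0 \<le> 1 + K" using order_trans[OF _ K] s by (simp add: oct_norm_def)
  fix h
  show "norm (moment_projection s f g h) \<le> (1 + K) * norm h"
  proof (rule norm_bound)
    fix t
    have prod: "\<bar>c * avg k h\<bar> \<le> \<bar>c\<bar> * norm h" if "k < 4" for c k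
      unfolding abs_mult using abs_avg_le_norm[OF that] by (rule mult_left_mono) simp
    have "\<bar>moment_projection s f g h t\<bar> \<le> \<bar>h t\<bar> + (\<bar>f t * avg 0 h\<bar> + \<bar>g t * avg 1 h\<bar>
        + \<bar>s * (f t + g t) * avg 2 h\<bar> + \<bar>s * (f t - g t) * avg 3 h\<bar>)"
      unfolding moment_projection_apply by linarith
    also have "\<dots> \<le> norm h + (\<bar>f t\<bar> * norm h + \<bar>g t\<bar> * norm h
        + \<bar>s * (f t + g t)\<bar> * norm h + \<bar>s * (f t - g t)\<bar> * norm h)"
      using norm_bounded[of h t] by (intro add_mono prod) auto
    also have "\<dots> = (1 + oct_norm s (f t) (g t)) * norm h"
      using s by (simp only: oct_norm_def abs_mult abs_of_nonneg) (simp add: algebra_simps)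
    also have "\<dots> \<le> (1 + K) * norm h"
      using K by (intro mult_right_mono) auto
    finally show "norm (moment_projection s f g h t) \<le> (1 + K) * norm h" by simp
  qed
qed

section \<open>Lower bound and non-attainment\<close>

text \<open>
  This is the trace of the rank-two projection \<open>Id - P\<close>, sorted by quarters.
\<close>

lemma trace_identity:
  assumes "biorthogonal s f g"
  shows "avg 0 f + avg 1 g + s * avg 2 (f + g) + s * avg 3 (f - g) = 2"
  using assms
  by (simp add: biorthogonal_def first_moment_def second_moment_def avg_add avg_diff algebra_simps)

lemma avg_bounds_of_oct_norm:
  fixes f g :: C01
  assumes s: "0 \<le> s" and K: "\<And>t. oct_norm s (f t) (g t) \<le> K"
  shows "f t \<le> K / (1 + 2 * s)" "g t \<le> K / (1 + 2 * s)"
    "avg 2 (f + g) \<le> K / (1 + s)" "avg 3 (f - g) \<le> K / (1 + s)"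
proof -
  have pos: "0 < 1 + 2 * s" "0 < 1 + s" using s by auto
  note ge = order_trans[OF oct_norm_ge(1)[OF s] K] order_trans[OF oct_norm_ge(2)[OF s] K]
    order_trans[OF oct_norm_ge(3)[OF s] K] order_trans[OF oct_norm_ge(4)[OF s] K]
  show "f t \<le> K / (1 + 2 * s)" "g t \<le> K / (1 + 2 * s)"
    using ge(1,2)[of t] pos by (auto simp: pos_le_divide_eq mult.commute)
  show "avg 2 (f + g) \<le> K / (1 + s)" "avg 3 (f - g) \<le> K / (1 + s)"
    using ge(3,4) pos(2)
    by (intro avg_le; simp add: pos_le_divide_eq mult.commute)+
qed

text \<open>
  If the curve stayed in the ball of radius \<open>oct_constant s\<close>, the trace identity would make
  the bounds on the means \<open>avg 0 f\<close> and \<open>avg 1 g\<close> sharp. Then \<open>f\<close> would be at its maximum on quarter \<open>0\<close> and \<open>g\<close> on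
  quarter \<open>1\<close>. At their common point the curve would lie on the diagonal with both coordinates
  equal to the coordinate of the vertex on an axis, outside the ball.
\<close>

lemma oct_norm_not_le_oct_constant:
  fixes f g :: C01
  assumes s: "0 \<le> s" and bi: "biorthogonal s f g"
  shows "\<exists>t. oct_constant s < oct_norm s (f t) (g t)"
proof (rule ccontr)
  assume "\<not> ?thesis"
  then have K: "oct_norm s (f t) (g t) \<le> oct_constant s" for t by (simp add: not_less)
  let ?M = "oct_constant s" and ?c = "oct_constant s / (1 + 2 * s)"
  note b = avg_bounds_of_oct_norm[OF s K]
  have le: "avg 0 f \<le> ?c" "avg 1 g \<le> ?c"
    using b(1,2) by (auto intro: avg_le)
  moreover have "s * avg 2 (f + g) \<le> s * (?M / (1 + s))" "s * avg 3 (f - g) \<le> s * (?M / (1 + s))"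
    by (rule mult_left_mono[OF b(3) s], rule mult_left_mono[OF b(4) s])
  moreover have "?c + s * (?M / (1 + s)) = 1"
    using oct_constant_eq[OF s] by (simp add: algebra_simps)
  ultimately have eq: "avg 0 f = ?c" "avg 1 g = ?c"
    using trace_identity[OF bi] by linarith+
  define t where "t = Abs_unit_interval (1 / 4)"
  have t: "Rep_unit_interval t = 1 / 4" by (simp add: t_def Abs_unit_interval_inverse)
  have "f t = ?c" "g t = ?c"
    using avg_eq_upper_bound_imp_eq[of 0 f ?c t] avg_eq_upper_bound_imp_eq[of 1 g ?c t] b(1,2) eq t
    by (auto simp: quarter_def)
  moreover have c: "0 < ?c" using oct_constant_pos[OF s] s by simp
  ultimately have "(2 + 2 * s) * ?c \<le> ?M"
    using K[of t] by (simp add: oct_norm_diagonal less_imp_le)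
  also have "\<dots> = (1 + 2 * s) * ?c" using s by simp
  finally have "2 + 2 * s \<le> 1 + 2 * s" using c by (rule mult_right_le_imp_le)
  then show False by simp
qed

section \<open>Almost optimal projections\<close>

definition normalized_plateau :: "nat \<Rightarrow> nat \<Rightarrow> C01"
  where "normalized_plateau n k = (1 / avg k (plateau k n)) *\<^sub>R plateau k n"

text \<open>
  On each quarter the curve moves along a segment from the origin to the optimal vertex and back:
  \<open>(a, 0)\<close> and \<open>(0, a)\<close> on quarters \<open>0\<close> and \<open>1\<close>, \<open>(b, b)\<close> and \<open>(b, - b)\<close> on quarters
  \<open>2\<close> and \<open>3\<close>. As the plateaus are normalized to have mean \<open>1\<close>, biorthogonality holds exactly;
  the price is a factor \<open>1 + e\<close> in the size.
\<close>

lemma almost_optimal_pair: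
  assumes s: "0 \<le> s" and e: "0 < e"
  obtains f g :: C01 where "biorthogonal s f g"
    "\<And>t. oct_norm s (f t) (g t) \<le> (1 + e) * oct_constant s"
proof -
  have "eventually (\<lambda>n. 1 / (1 + e) < avg k (plateau k n)) sequentially" if "k < 4" for k
    using e by (intro order_tendstoD(1)[OF avg_plateau_tendsto[OF that]]) simp
  then have "eventually (\<lambda>n. \<forall>k\<in>{..<4}. 1 / (1 + e) < avg k (plateau k n)) sequentially"
    by (intro eventually_ball_finite) auto
  then obtain n where n: "\<And>k. k < 4 \<Longrightarrow> 1 / (1 + e) < avg k (plateau k n)"
    by (auto dest!: eventually_happens)
  define u where "u k = normalized_plateau n k" for k
  define a b where "a = oct_constant s / (1 + 2 * s)" and "b = oct_constant s / (2 + 2 * s)"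
  have pos: "0 < avg k (plateau k n)" if "k < 4" for k
    using n[OF that] e by (smt (verit) divide_pos_pos)
  have avg_u: "avg j (u k) = (if j = k then 1 else 0)" if "j < 4" "k < 4" for j k
    using pos[of k] that
    by (auto simp: u_def normalized_plateau_def avg_scaleR avg_plateau_other)
  have u_range: "0 \<le> u k t" "u k t \<le> 1 + e" if "k < 4" for k t
  proof -
    show "0 \<le> u k t"
      using pos[OF that] plateau_range[of k n t] by (simp add: u_def normalized_plateau_def)
    have "plateau k n t \<le> (1 + e) * avg k (plateau k n)"
      using mult_strict_left_mono[OF n[OF that], of "1 + e"] e plateau_range(2)[of k n t] by simp
    then show "u k t \<le> 1 + e"
      using pos[OF that] by (simp add: u_def normalized_plateau_def divide_le_eq)
  qed
  have u_disjoint: "u j t = 0 \<or> u k t = 0" if "j \<noteq> k" for j k t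
    using plateau_disjoint[of j n t k] that by (auto simp: u_def normalized_plateau_def)
  have u_sum: "u 0 t + u 1 t + u 2 t + u 3 t \<le> 1 + e" for t
  proof -
    have "u 0 t = 0 \<or> u 1 t = 0" "u 0 t = 0 \<or> u 2 t = 0" "u 0 t = 0 \<or> u 3 t = 0"
      "u 1 t = 0 \<or> u 2 t = 0" "u 1 t = 0 \<or> u 3 t = 0" "u 2 t = 0 \<or> u 3 t = 0"
      by (rule u_disjoint, simp)+
    moreover have "u 0 t \<le> 1 + e" "u 1 t \<le> 1 + e" "u 2 t \<le> 1 + e" "u 3 t \<le> 1 + e"
      by (simp_all add: u_range(2))
    ultimately show ?thesis using e by linarith
  qed
  have ab: "0 \<le> a" "0 \<le> b" using oct_constant_pos[OF s] s by (auto simp: a_def b_def)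
  have a: "(1 + 2 * s) * a = oct_constant s" and b: "(2 + 2 * s) * b = oct_constant s"
    using s by (auto simp: a_def b_def)
  have "2 * s * b = oct_constant s * (s / (1 + s))"
    using s by (simp add: b_def field_simps)
  then have ab1: "a + 2 * s * b = 1"
    using oct_constant_eq[OF s] by (simp add: a_def distrib_left)
  define f where "f = a *\<^sub>R u 0 + b *\<^sub>R u 2 + b *\<^sub>R u 3"
  define g where "g = a *\<^sub>R u 1 + b *\<^sub>R u 2 - b *\<^sub>R u 3"
  have "avg 0 f = a" "avg 1 f = 0" "avg 2 f = b" "avg 3 f = b"
    "avg 0 g = 0" "avg 1 g = a" "avg 2 g = b" "avg 3 g = - b"
    by (simp_all add: f_def g_def avg_add avg_diff avg_scaleR avg_u)
  then have "biorthogonal s f g"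
    using ab1 by (simp add: biorthogonal_def first_moment_def second_moment_def algebra_simps)
  moreover have "oct_norm s (f t) (g t) \<le> (1 + e) * oct_constant s" for t
  proof -
    define p q r w where "p = a * u 0 t" and "q = a * u 1 t" and "r = b * u 2 t" and "w = b * u 3 t"
    have nonneg: "0 \<le> p" "0 \<le> q" "0 \<le> r" "0 \<le> w"
      unfolding p_def q_def r_def w_def
      by (intro mult_nonneg_nonneg ab u_range(1); simp)+
    have f: "f t = p + r + w" and g: "g t = q + r - w"
      by (simp_all add: f_def g_def p_def q_def r_def w_def)
    have "\<bar>f t\<bar> \<le> p + r + w" "\<bar>g t\<bar> \<le> q + r + w"
      unfolding f g using nonneg by linarith+
    \<comment> \<open>In \<open>f + g\<close> the contribution of quarter \<open>3\<close> cancels, in \<open>f - g\<close> that of quarter \<open>2\<close>.\<close>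
    moreover have "\<bar>f t + g t\<bar> \<le> p + q + 2 * r" "\<bar>f t - g t\<bar> \<le> p + q + 2 * w"
      unfolding f g using nonneg by linarith+
    then have "s * (\<bar>f t + g t\<bar> + \<bar>f t - g t\<bar>) \<le> s * (2 * (p + q + r + w))"
      using s by (intro mult_left_mono) auto
    ultimately have "oct_norm s (f t) (g t) \<le> p + q + 2 * r + 2 * w + s * (2 * (p + q + r + w))"
      unfolding oct_norm_def by linarith
    also have "\<dots> = (1 + 2 * s) * p + (1 + 2 * s) * q + (2 + 2 * s) * r + (2 + 2 * s) * w"
      by (simp add: algebra_simps)
    also have "\<dots> = oct_constant s * (u 0 t + u 1 t + u 2 t + u 3 t)"
      unfolding p_def q_def r_def w_def mult.assoc[symmetric] a b by (simp add: distrib_left)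
    also have "\<dots> \<le> oct_constant s * (1 + e)"
      using u_sum oct_constant_pos[OF s] by (intro mult_left_mono) auto
    finally show ?thesis by (simp add: mult.commute)
  qed
  ultimately show ?thesis by (rule that)
qed

section \<open>The projection constant\<close>

lemma onorm_projection_gt:
  assumes s: "0 \<le> s" and P: "P \<in> projections_onto (moment_kernel s)"
  shows "1 + oct_constant s < onorm P"
proof -
  obtain u v where "biorthogonal s u v"
    using almost_optimal_pair[OF s zero_less_one] by blast
  then obtain f g :: C01 where bi: "biorthogonal s f g" and P_eq: "P = moment_projection s f g"
    using projection_eq_moment_projection[OF P] by blast
  obtain t where "oct_constant s < oct_norm s (f t) (g t)"
    using oct_norm_not_le_oct_constant[OF s bi] by blast
  then show ?thesis
    using oct_norm_le_onorm[OF s, of f t g] unfolding P_eq by linarith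
qed

lemma projection_constant_moment_kernel:
  assumes s: "0 \<le> s"
  shows "projection_constant (moment_kernel s) = ereal (1 + oct_constant s)"
proof (rule antisym)
  show "projection_constant (moment_kernel s) \<le> ereal (1 + oct_constant s)"
  proof (rule ereal_le_epsilon2)
    fix \<epsilon> :: real assume \<epsilon>: "0 < \<epsilon>"
    define e where "e = \<epsilon> / oct_constant s"
    have M: "0 < oct_constant s" by (rule oct_constant_pos[OF s])
    then have e: "0 < e" using \<epsilon> by (simp add: e_def)
    obtain f g :: C01 where bi: "biorthogonal s f g"
        and K: "\<And>t. oct_norm s (f t) (g t) \<le> (1 + e) * oct_constant s"
      using almost_optimal_pair[OF s e] by blast
    have "projection_constant (moment_kernel s) \<le> ereal (onorm (moment_projection s f g))"
      unfolding projection_constant_def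
      by (rule INF_lower[OF moment_projection_in_projections[OF bi]])
    also have "\<dots> \<le> ereal (1 + (1 + e) * oct_constant s)"
      using onorm_moment_projection_le[OF s K] by simp
    also have "\<dots> = ereal (1 + oct_constant s) + ereal \<epsilon>"
      using M by (simp add: e_def field_simps)
    finally show "projection_constant (moment_kernel s) \<le> ereal (1 + oct_constant s) + ereal \<epsilon>" .
  qed
  show "ereal (1 + oct_constant s) \<le> projection_constant (moment_kernel s)"
    unfolding projection_constant_def
    using onorm_projection_gt[OF s] by (intro INF_greatest) (simp add: less_imp_le)
qed

theorem theorem5p2:
  fixes \<Lambda> :: real
  assumes "2 < \<Lambda>" and "\<Lambda> \<le> (3 + sqrt 2) / 2"
  shows "\<exists>Y :: C01 set. subspace Y \<and> closed Y \<and> has_codimension Y 2 \<and>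
    projection_constant Y = ereal \<Lambda> \<and> \<not> projection_constant_attained Y"
proof -
  obtain s where s: "0 < s" "oct_constant s = \<Lambda> - 1"
    using assms by (auto intro: oct_constant_onto[of "\<Lambda> - 1"] simp: field_simps)
  then have s0: "0 \<le> s" by simp
  obtain f g where bi: "biorthogonal s f g"
    using almost_optimal_pair[OF s0 zero_less_one] by blast
  have const: "projection_constant (moment_kernel s) = ereal \<Lambda>"
    using projection_constant_moment_kernel[OF s0] s by simp
  have "\<not> projection_constant_attained (moment_kernel s)"
    unfolding projection_constant_attained_def const
    using onorm_projection_gt[OF s0] s by force
  then show ?thesis
    using subspace_moment_kernel closed_moment_kernel has_codimension_moment_kernel[OF bi] const
    by blast
qed

end
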